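(* Let $(A_n)_{n\ge1}$ be a strictly stationary, ergodic process of random $p\times p$ nonnegative column-allowable matrices that is weakly sequentially primitive and satisfies $\mathbb E\log^+\|A_1\|<\infty$. Let $\lambda_1\ge\lambda_2$ be its first two Lyapunov exponents, let $M_n=A_nA_{n-1}\cdots A_1$, assume $\lambda_1-\lambda_2>0$, and assume that for any pair of row indices $i,j$ and any column index $k$ the process $M_n^{ik}/M_n^{jk}$ is weakly subexponential. Assume moreover that $A_n$ is column stochastic for all $n$. Then for any vector of initial values $x\in\mathbb R^p$ and any nonnegative vector of initial weights $w\in\mathbb R^p_+$, $w\neq0$, we have almost surely for all $i=1,\dots,p$ $$\limsup_{\substack{n\to\infty\\ e_i^\top M_n\neq 0}}\frac1n\log\left|\frac{e_i^\top M_nx}{e_i^\top M_nw}-\frac{\mathbf 1^\top x}{\mathbf 1^\top w}\right|\le\lambda_2<0.$$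
   Context: $\mathbb R^p_+$ denotes the set of nonnegative, nonzero vectors of $\mathbb R^p$; $\mathbf 1=(1,\dots,1)^\top$; $e_i$ is the $i$th unit vector; $M_n^{ik}$ is the $(i,k)$ entry of $M_n$; $\log0=-\infty$, and a limsup over only finitely many indices $n$ is $-\infty$. Column stochastic: nonnegative with every column summing to $1$. A nonnegative matrix is column-allowable if each of its columns contains a strictly positive entry. A strictly stationary process of nonnegative column-allowable matrices $(A_n)_{n\ge1}$ is weakly (forward) sequentially primitive if there is an almost surely finite stopping time $\tau$ such that each row of $M_\tau=A_\tau\cdots A_1$ is either strictly positive or zero. A process $(\xi_n)$ (possibly taking the value $\infty$) is weakly subexponential if for any $\varepsilon>0$, almost surely, for all $n$ with finitely many exceptions, $|\xi_n|\le e^{\varepsilon n}$ or $\xi_n=\infty$. For ratios of entries, $a/0=\infty$ for $a>0$, and indices $n$ with $0/0$ are disregarded. Lyapunov exponents: for a realization of the sequence and $x\in\mathbb R^p$ put $\lambda(x)=\limsup_n\frac1n\log|A_n\cdots A_1x|$ and $L_\mu=\{x:\lambda(x)\le\mu\}$, a linear subspace. There are finitely many values $\mu_1>\dots>\mu_q\ge-\infty$ with $\mathbb R^p=L_{\mu_1}\supsetneq\dots\supsetneq L_{\mu_q}\supsetneq\{0\}=:L_{\mu_{q+1}}$, $\lambda(x)=\mu_r$ on $L_{\mu_r}\setminus L_{\mu_{r+1}}$. The full spectrum $\lambda_1\ge\lambda_2\ge\dots\ge\lambda_p\ge-\infty$ lists each $\mu_r$ with multiplicity $\dim L_{\mu_r}-\dim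 L_{\mu_{r+1}}$. Under stationarity, ergodicity and $\mathbb E\log^+\|A_1\|<\infty$, the exponents are almost surely deterministic (Oseledec). *)

theory Defs
  imports "HOL-Probability.Probability"
begin

text \<open>
  All processes are indexed by the positive integers: a process \<open>X :: nat \<Rightarrow> _\<close> is only
  considered at the times \<open>n \<ge> 1\<close>, and the value at \<open>0\<close> is irrelevant.
\<close>

section \<open>Nonnegative matrices\<close>

definition nonneg_mat :: "real^'n^'m \<Rightarrow> bool" where
  "nonneg_mat B \<longleftrightarrow> (\<forall>i j. 0 \<le> B $ i $ j)"

definition column_allowable :: "real^'n^'m \<Rightarrow> bool" where
  "column_allowable B \<longleftrightarrow> (\<forall>j. \<exists>i. 0 < B $ i $ j)"

definition column_stochastic :: "real^'n^'m \<Rightarrow> bool" where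
  "column_stochastic B \<longleftrightarrow> nonneg_mat B \<and> (\<forall>j. (\<Sum>i\<in>UNIV. B $ i $ j) = 1)"

definition rows_positive_or_zero :: "real^'n^'m \<Rightarrow> bool" where
  "rows_positive_or_zero B \<longleftrightarrow> (\<forall>i. (\<forall>j. 0 < B $ i $ j) \<or> row i B = 0)"

text \<open>\<open>mprod B n\<close> is the product \<open>B n ** \<dots> ** B 1\<close>.\<close>

primrec mprod :: "(nat \<Rightarrow> real^'n^'n) \<Rightarrow> nat \<Rightarrow> real^'n^'n" where
  "mprod B 0 = mat 1"
| "mprod B (Suc n) = B (Suc n) ** mprod B n"

section \<open>Stationary and ergodic processes, stopping times\<close>

definition strictly_stationary :: "'w measure \<Rightarrow> (nat \<Rightarrow> 'w \<Rightarrow> 'b::topological_space) \<Rightarrow> bool" where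
  "strictly_stationary M X \<longleftrightarrow>
     (\<forall>h. distr M (\<Pi>\<^sub>M n\<in>(UNIV::nat set). borel) (\<lambda>\<omega> n. X (Suc (n + h)) \<omega>) =
          distr M (\<Pi>\<^sub>M n\<in>(UNIV::nat set). borel) (\<lambda>\<omega> n. X (Suc n) \<omega>))"

text \<open>Every shift-invariant event of the path space has probability \<open>0\<close> or \<open>1\<close>.\<close>

definition ergodic_process :: "'w measure \<Rightarrow> (nat \<Rightarrow> 'w \<Rightarrow> 'b::topological_space) \<Rightarrow> bool" where
  "ergodic_process M X \<longleftrightarrow>
     (\<forall>E \<in> sets (\<Pi>\<^sub>M n\<in>(UNIV::nat set). borel).
        (\<lambda>s n. s (Suc n)) -` E = E \<longrightarrow>
        measure M {\<omega> \<in> space M. (\<lambda>n. X (Suc n) \<omega>) \<in> E} \<in> {0, 1})"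

text \<open>The time set is \<^typ>\<open>enat\<close>, so that stopping times may take the value \<open>\<infinity>\<close>.\<close>

definition natural_filtration ::
    "'w measure \<Rightarrow> (nat \<Rightarrow> 'w \<Rightarrow> 'b::topological_space) \<Rightarrow> enat \<Rightarrow> 'w measure" where
  "natural_filtration M X t =
     sigma (space M) {X k -` E \<inter> space M | k E. 1 \<le> k \<and> enat k \<le> t \<and> E \<in> sets borel}"

definition weakly_sequentially_primitive :: "'w measure \<Rightarrow> (nat \<Rightarrow> 'w \<Rightarrow> real^'n^'n) \<Rightarrow> bool" where
  "weakly_sequentially_primitive M A \<longleftrightarrow>
     (\<exists>\<tau> :: 'w \<Rightarrow> enat. stopping_time (natural_filtration M A) \<tau> \<and>
        (AE \<omega> in M. \<exists>n\<ge>1. \<tau> \<omega> = enat n \<and> rows_positive_or_zero (mprod (\<lambda>k. A k \<omega>) n)))"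

definition weakly_subexponential :: "'w measure \<Rightarrow> (nat \<Rightarrow> 'w \<Rightarrow> ereal) \<Rightarrow> bool" where
  "weakly_subexponential M \<xi> \<longleftrightarrow>
     (\<forall>\<epsilon>>0. AE \<omega> in M. \<forall>\<^sub>F n in sequentially.
        \<bar>\<xi> n \<omega>\<bar> \<le> ereal (exp (\<epsilon> * real n)) \<or> \<xi> n \<omega> = \<infinity>)"

text \<open>
  In \<^typ>\<open>ereal\<close>, \<open>a / 0 = \<infinity>\<close> for \<open>a > 0\<close>, as wanted, and \<open>0 / 0 = 0\<close>. The value \<open>0\<close>
  satisfies every subexponential bound, so indices with \<open>0 / 0\<close> impose no condition.
\<close>

definition entry_ratio :: "(nat \<Rightarrow> 'w \<Rightarrow> real^'n^'n) \<Rightarrow> 'n \<Rightarrow> 'n \<Rightarrow> 'n \<Rightarrow> nat \<Rightarrow> 'w \<Rightarrow> ereal" where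
  "entry_ratio A i j k n \<omega> =
     ereal (mprod (\<lambda>l. A l \<omega>) n $ i $ k) / ereal (mprod (\<lambda>l. A l \<omega>) n $ j $ k)"

section \<open>Lyapunov exponents of a sequence of matrices\<close>

definition elog :: "real \<Rightarrow> ereal" where
  "elog y = (if y = 0 then - \<infinity> else ereal (ln y))"

definition growth_rate :: "(nat \<Rightarrow> real^'n^'n) \<Rightarrow> real^'n \<Rightarrow> ereal" where
  "growth_rate B x = limsup (\<lambda>n. elog (norm (mprod B n *v x)) / ereal (real n))"

definition lyap_space :: "(nat \<Rightarrow> real^'n^'n) \<Rightarrow> ereal \<Rightarrow> (real^'n) set" where
  "lyap_space B \<mu> = {x. growth_rate B x \<le> \<mu>}"

text \<open>The distinct values \<open>\<mu>\<^sub>1 > \<dots> > \<mu>\<^sub>q\<close> as a list in decreasing order; there are at most \<open>CARD('n)\<close> of them.\<close>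

definition lyap_values :: "(nat \<Rightarrow> real^'n^'n) \<Rightarrow> ereal list" where
  "lyap_values B = rev (sorted_list_of_set (growth_rate B ` (- {0})))"

text \<open>
  Each \<open>\<mu>\<^sub>r\<close> is repeated \<open>dim L\<^sub>r - dim L\<^sub>r\<^sub>+\<^sub>1\<close> times, where \<open>L\<^sub>r\<close> is \<^const>\<open>lyap_space\<close> at
  \<open>\<mu>\<^sub>r\<close> and the space following the last one is \<open>{0}\<close>.
\<close>

fun with_multiplicity :: "(nat \<Rightarrow> real^'n^'n) \<Rightarrow> ereal list \<Rightarrow> ereal list" where
  "with_multiplicity B [] = []"
| "with_multiplicity B [\<mu>] = replicate (dim (lyap_space B \<mu>) - dim {0 :: real^'n}) \<mu>"
| "with_multiplicity B (\<mu> # \<nu> # \<mu>s) =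
     replicate (dim (lyap_space B \<mu>) - dim (lyap_space B \<nu>)) \<mu> @ with_multiplicity B (\<nu> # \<mu>s)"

text \<open>\<open>lyapunov_exponent B k\<close> is \<open>\<lambda>\<^sub>k\<close>, for \<open>1 \<le> k \<le> CARD('n)\<close>.\<close>

definition lyapunov_exponent :: "(nat \<Rightarrow> real^'n^'n) \<Rightarrow> nat \<Rightarrow> ereal" where
  "lyapunov_exponent B k = with_multiplicity B (lyap_values B) ! (k - 1)"

section \<open>Upper limits along a set of indices\<close>

text \<open>If \<open>S\<close> is finite the filter is trivial and the value is \<open>- \<infinity>\<close>.\<close>

definition limsup_along :: "nat set \<Rightarrow> (nat \<Rightarrow> ereal) \<Rightarrow> ereal" where
  "limsup_along S f = Limsup (inf sequentially (principal S)) f"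

end

theory Submission
  imports Defs
begin

text \<open>
  Column stochasticity makes \<open>1 \<bullet> _\<close> invariant under \<open>M\<^sub>n\<close>, so every vector outside the hyperplane
  \<open>H = {v. 1 \<bullet> v = 0}\<close> has growth rate \<open>0\<close>, which is the largest possible one. Since
  \<open>\<lambda>\<^sub>2 < \<lambda>\<^sub>1 = 0\<close>, the second space of the Lyapunov filtration has codimension one and lies in \<open>H\<close>,
  hence equals \<open>H\<close>. The error is \<open>(M\<^sub>n y)\<^sub>i / (M\<^sub>n w)\<^sub>i\<close> with \<open>y = x - (1 \<bullet> x / 1 \<bullet> w) w \<in> H\<close>, whose
  numerator therefore grows at rate at most \<open>\<lambda>\<^sub>2\<close>. After the time \<open>\<tau>\<close>, nonzero rows of \<open>M\<^sub>n\<close>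
  are positive, and comparison with the largest entry of a column (at least \<open>1/p\<close>)
  shows that the denominator is bounded below by \<open>e\<^sup>-\<^sup>\<epsilon>\<^sup>n\<close> up to a constant.
\<close>

section \<open>Exponential growth rates\<close>

lemma elog_div_le_iff:
  assumes "0 \<le> a" "0 < n"
  shows "elog a / ereal (real n) \<le> ereal r \<longleftrightarrow> a \<le> exp (r * real n)"
proof (cases "a = 0")
  case True
  then show ?thesis using assms by (simp add: elog_def)
next
  case False
  then have "a > 0" using assms by simp
  then have "a \<le> exp (r * real n) \<longleftrightarrow> ln a \<le> r * real n"
    by (metis ln_exp ln_le_cancel_iff exp_gt_zero)
  then show ?thesis using False assms by (simp add: elog_def field_simps)
qed

lemma eventually_mult_exp_le:
  fixes C r s :: real
  assumes "r < s"
  shows "\<forall>\<^sub>F n in sequentially. C * exp (r * real n) \<le> exp (s * real n)"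
proof -
  have "filterlim (\<lambda>n. exp ((s - r) * real n)) at_top sequentially"
    using assms
    by (intro filterlim_compose[OF exp_at_top] filterlim_tendsto_pos_mult_at_top[OF tendsto_const]
        filterlim_real_sequentially) auto
  then have "\<forall>\<^sub>F n in sequentially. C \<le> exp ((s - r) * real n)"
    by (auto simp: filterlim_at_top)
  then show ?thesis
  proof eventually_elim
    case (elim n)
    then have "C * exp (r * real n) \<le> exp ((s - r) * real n) * exp (r * real n)"
      by (intro mult_right_mono) auto
    also have "\<dots> = exp (s * real n)" by (simp add: exp_add[symmetric] algebra_simps)
    finally show ?case .
  qed
qed

text \<open>The constant \<open>C\<close> is absorbed by raising the exponent slightly, so only the
  exponential rate matters. The filter \<open>F\<close> is general because the limsup is needed both
  over all times and along the times at which a given row is nonzero.\<close>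

lemma Limsup_elog_leI:
  assumes F: "F \<le> sequentially" and f: "\<And>n. 0 \<le> f n"
    and b: "\<And>r. \<mu> < ereal r \<Longrightarrow> \<exists>C. \<forall>\<^sub>F n in F. f n \<le> C * exp (r * real n)"
  shows "Limsup F (\<lambda>n. elog (f n) / ereal (real n)) \<le> \<mu>"
  unfolding Limsup_le_iff
proof (intro allI impI)
  fix y assume "\<mu> < y"
  \<comment> \<open>The gap between \<open>r\<close> and \<open>s\<close> absorbs \<open>C\<close>;
    the gap between \<open>s\<close> and \<open>y\<close> makes the final inequality strict.\<close>
  then obtain s where s: "\<mu> < ereal s" "ereal s < y" using ereal_dense2 by blast
  then obtain r where r: "\<mu> < ereal r" "r < s" by (metis ereal_dense2 less_ereal.simps(1))
  then obtain C where C: "\<forall>\<^sub>F n in F. f n \<le> C * exp (r * real n)" using b by blast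
  have "\<forall>\<^sub>F n in F. C * exp (r * real n) \<le> exp (s * real n) \<and> 0 < n"
    using filter_leD[OF F eventually_conj[OF eventually_mult_exp_le[OF r(2)] eventually_gt_at_top]] .
  with C show "\<forall>\<^sub>F n in F. elog (f n) / ereal (real n) < y"
  proof eventually_elim
    case (elim n)
    then have "elog (f n) / ereal (real n) \<le> ereal s" using f elog_div_le_iff by force
    then show ?case using s by simp
  qed
qed

lemma Limsup_elog_leD:
  assumes F: "F \<le> sequentially" and f: "\<And>n. 0 \<le> f n"
    and L: "Limsup F (\<lambda>n. elog (f n) / ereal (real n)) \<le> \<mu>" and r: "\<mu> < ereal r"
  shows "\<forall>\<^sub>F n in F. f n \<le> exp (r * real n)"
proof -
  have "\<forall>\<^sub>F n in F. 0 < n" using filter_leD[OF F eventually_gt_at_top] .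
  moreover have "\<forall>\<^sub>F n in F. elog (f n) / ereal (real n) < ereal r"
    using L r unfolding Limsup_le_iff by blast
  ultimately show ?thesis
    by eventually_elim (use f elog_div_le_iff in \<open>auto dest: less_imp_le\<close>)
qed

lemma growth_rate_leI:
  assumes "\<And>r. \<mu> < ereal r \<Longrightarrow> \<exists>C. \<forall>\<^sub>F n in sequentially. norm (mprod B n *v x) \<le> C * exp (r * real n)"
  shows "growth_rate B x \<le> \<mu>"
  unfolding growth_rate_def using assms by (intro Limsup_elog_leI) auto

lemma growth_rate_leD:
  assumes "growth_rate B x \<le> \<mu>" "\<mu> < ereal r"
  shows "\<forall>\<^sub>F n in sequentially. norm (mprod B n *v x) \<le> exp (r * real n)"
  using Limsup_elog_leD[OF order.refl _ assms(1)[unfolded growth_rate_def] assms(2)] by simp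

section \<open>The Lyapunov filtration and its dimensions\<close>

lemma subspace_lyap_space: "subspace (lyap_space B \<mu>)"
  unfolding subspace_def lyap_space_def mem_Collect_eq
proof (intro conjI ballI allI; (unfold mem_Collect_eq)?)
  show "growth_rate B 0 \<le> \<mu>"
    by (rule growth_rate_leI) (auto intro!: exI[of _ 0])
next
  fix x y assume xy: "growth_rate B x \<le> \<mu>" "growth_rate B y \<le> \<mu>"
  show "growth_rate B (x + y) \<le> \<mu>"
  proof (rule growth_rate_leI)
    fix r assume r: "\<mu> < ereal r"
    have "\<forall>\<^sub>F n in sequentially. norm (mprod B n *v (x + y)) \<le> 2 * exp (r * real n)"
      using growth_rate_leD[OF xy(1) r] growth_rate_leD[OF xy(2) r]
    proof eventually_elim
      case (elim n)
      then show ?case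
        using norm_triangle_ineq[of "mprod B n *v x" "mprod B n *v y"]
        by (simp add: matrix_vector_right_distrib)
    qed
    then show "\<exists>C. \<forall>\<^sub>F n in sequentially. norm (mprod B n *v (x + y)) \<le> C * exp (r * real n)"
      by blast
  qed
next
  fix c :: real and x assume x: "growth_rate B x \<le> \<mu>"
  show "growth_rate B (c *\<^sub>R x) \<le> \<mu>"
  proof (rule growth_rate_leI)
    fix r assume r: "\<mu> < ereal r"
    have "\<forall>\<^sub>F n in sequentially. norm (mprod B n *v (c *\<^sub>R x)) \<le> \<bar>c\<bar> * exp (r * real n)"
      using growth_rate_leD[OF x r]
      by eventually_elim (simp add: matrix_vector_mult_scaleR mult_left_mono)
    then show "\<exists>C. \<forall>\<^sub>F n in sequentially. norm (mprod B n *v (c *\<^sub>R x)) \<le> C * exp (r * real n)"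
      by blast
  qed
qed

text \<open>A vector of growth rate \<nu> lies in the larger subspace but not in the smaller one.
  This strictness makes all multiplicities positive.\<close>

lemma dim_lyap_space_less:
  assumes "\<mu> < \<nu>" "\<nu> \<in> growth_rate B ` (- {0})"
  shows "dim (lyap_space B \<mu>) < dim (lyap_space B \<nu>)"
proof -
  obtain v where "growth_rate B v = \<nu>" using assms(2) by blast
  then have "v \<in> lyap_space B \<nu> - lyap_space B \<mu>" using assms(1) by (simp add: lyap_space_def)
  moreover have "lyap_space B \<mu> \<subseteq> lyap_space B \<nu>" using assms(1) by (auto simp: lyap_space_def)
  ultimately have "lyap_space B \<mu> \<subset> lyap_space B \<nu>" by blast
  then show ?thesis by (intro dim_psubset) (simp add: span_eq_iff[THEN iffD2, OF subspace_lyap_space])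
qed

text \<open>The dimension of \<open>lyap_space\<close> separates the values and is bounded by that
  of the whole space. Finiteness is what gives \<open>sorted_list_of_set\<close> its meaning in
  \<open>lyap_values\<close>.\<close>

lemma finite_growth_rates: "finite (growth_rate B ` (- {0}))"
proof (rule inj_on_finite)
  show "inj_on (\<lambda>\<mu>. dim (lyap_space B \<mu>)) (growth_rate B ` (- {0}))"
  proof (rule inj_onI, rule ccontr)
    fix \<mu> \<nu>
    assume "\<mu> \<in> growth_rate B ` (- {0})" "\<nu> \<in> growth_rate B ` (- {0})" "\<mu> \<noteq> \<nu>"
      and "dim (lyap_space B \<mu>) = dim (lyap_space B \<nu>)"
    then show False
      using dim_lyap_space_less[of \<mu> \<nu> B] dim_lyap_space_less[of \<nu> \<mu> B]
      by (metis linorder_neqE less_irrefl)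
  qed
  show "(\<lambda>\<mu>. dim (lyap_space B \<mu>)) ` (growth_rate B ` (- {0})) \<subseteq> {.. DIM(real^'a)}"
    using dim_subset_UNIV by blast
qed simp

lemma set_lyap_values: "set (lyap_values B) = growth_rate B ` (- {0})"
  by (simp add: lyap_values_def finite_growth_rates)

lemma sorted_lyap_values: "sorted_wrt (>) (lyap_values B)"
  by (simp add: lyap_values_def sorted_wrt_rev)

lemma lyap_space_top:
  assumes "\<And>v. v \<noteq> 0 \<Longrightarrow> growth_rate B v \<le> \<mu>"
  shows "lyap_space B \<mu> = UNIV"
proof -
  have "growth_rate B 0 \<le> \<mu>"
    using subspace_0[OF subspace_lyap_space, of B \<mu>] by (simp add: lyap_space_def)
  then have "growth_rate B v \<le> \<mu>" for v using assms by (cases "v = 0") auto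
  then show ?thesis by (simp add: lyap_space_def)
qed

text \<open>The multiplicity of the largest value is the codimension of the next space in the
  filtration. A gap between the first two exponents forces it to be one, so the second exponent is
  the second distinct value.\<close>

lemma simple_top_exponent:
  fixes B :: "nat \<Rightarrow> real^'p^'p"
  assumes p: "2 \<le> CARD('p)"
    and gap: "lyapunov_exponent B 2 < lyapunov_exponent B 1"
  shows "lyapunov_exponent B 1 \<in> range (growth_rate B)"
    and "dim (lyap_space B (lyapunov_exponent B 2)) = CARD('p) - 1"
proof -
  have "- {0} \<noteq> ({} :: (real^'p) set)"
    using axis_eq_0_iff[of _ "1::real"] by (metis Compl_iff empty_iff singletonD zero_neq_one)
  then obtain \<mu> l where ml: "lyap_values B = \<mu> # l"
    using set_lyap_values[of B] by (metis image_is_empty list.exhaust list.set(1))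
  have le: "growth_rate B u \<le> \<mu>" if "u \<noteq> 0" for u
    using that set_lyap_values[of B] sorted_lyap_values[of B] unfolding ml
    by (metis ComplI image_eqI less_imp_le order.refl set_ConsD singletonD sorted_wrt.simps(2))
  then have "lyap_space B \<mu> = UNIV" by (rule lyap_space_top)
  then have dtop: "dim (lyap_space B \<mu>) = CARD('p)" by simp
  \<comment> \<open>A single value would fill all positions of the spectrum, of which there are at
    least two, contradicting the gap.\<close>
  have False if "l = []"
    using gap p that dtop by (simp add: lyapunov_exponent_def ml)
  then obtain \<nu> l' where l: "l = \<nu> # l'" by (cases l) auto
  define m where "m = CARD('p) - dim (lyap_space B \<nu>)"
  have wm: "with_multiplicity B (lyap_values B) = replicate m \<mu> @ with_multiplicity B (\<nu> # l')"
    by (simp add: ml l m_def dtop)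
  have "\<nu> < \<mu>" "\<mu> \<in> growth_rate B ` (- {0})"
    using sorted_lyap_values[of B] set_lyap_values[of B] by (auto simp: ml l)
  from dim_lyap_space_less[OF this] have m0: "0 < m" by (simp add: m_def dtop)
  \<comment> \<open>Otherwise positions \<open>0\<close> and \<open>1\<close>, which hold the first
    two exponents, would both contain \<mu>.\<close>
  have "\<not> 2 \<le> m" using gap by (auto simp: lyapunov_exponent_def wm nth_append)
  with m0 have m1: "m = 1" by simp
  have e1: "lyapunov_exponent B 1 = \<mu>" by (simp add: lyapunov_exponent_def wm m1)
  have nu: "\<nu> \<in> growth_rate B ` (- {0})" using set_lyap_values[of B] by (auto simp: ml l)
  \<comment> \<open>The block of copies of \<nu> must be nonempty. If \<nu> is the last value, it is
    compared with the zero space, otherwise with the next space.\<close>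
  have "with_multiplicity B (\<nu> # l') ! 0 = \<nu>"
  proof (cases l')
    case Nil
    obtain u where "u \<noteq> 0" "growth_rate B u = \<nu>" using nu by auto
    then have "\<not> lyap_space B \<nu> \<subseteq> {0}" by (auto simp: lyap_space_def)
    then have "dim (lyap_space B \<nu>) > 0" by (metis dim_eq_0 gr0I)
    then show ?thesis by (simp add: Nil)
  next
    case (Cons \<kappa> l'')
    have "\<kappa> < \<nu>" using sorted_lyap_values[of B] by (auto simp: ml l Cons)
    from dim_lyap_space_less[OF this nu] show ?thesis by (simp add: Cons nth_append)
  qed
  then have e2: "lyapunov_exponent B 2 = \<nu>" by (simp add: lyapunov_exponent_def wm m1)
  show "lyapunov_exponent B 1 \<in> range (growth_rate B)"
    unfolding e1 using \<open>\<mu> \<in> growth_rate B ` (- {0})\<close> by blast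
  show "dim (lyap_space B (lyapunov_exponent B 2)) = CARD('p) - 1"
    using m1 by (simp add: e2 m_def)
qed

section \<open>Products of column stochastic matrices\<close>

lemma one_inner_vec: "1 \<bullet> x = (\<Sum>i\<in>UNIV. x $ i)" for x :: "real^'n"
  by (simp add: inner_vec_def)

lemma column_stochastic_mat1: "column_stochastic (mat 1)"
  by (simp add: column_stochastic_def nonneg_mat_def mat_def)

lemma nonneg_mat_mult: "nonneg_mat B \<Longrightarrow> nonneg_mat C \<Longrightarrow> nonneg_mat (B ** C)"
  by (simp add: nonneg_mat_def matrix_matrix_mult_def sum_nonneg)

lemma column_stochastic_mult:
  assumes "column_stochastic B" "column_stochastic C"
  shows "column_stochastic (B ** C)"
proof -
  have "(\<Sum>i\<in>UNIV. (B ** C) $ i $ j) = 1" for j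
  proof -
    have "(\<Sum>i\<in>UNIV. (B ** C) $ i $ j) = (\<Sum>k\<in>UNIV. (\<Sum>i\<in>UNIV. B $ i $ k) * C $ k $ j)"
      unfolding matrix_matrix_mult_def by (simp add: sum_distrib_right) (rule sum.swap)
    then show ?thesis using assms by (simp add: column_stochastic_def)
  qed
  then show ?thesis
    using assms nonneg_mat_mult unfolding column_stochastic_def by blast
qed

lemma column_stochastic_mprod:
  assumes "\<forall>n\<ge>1. column_stochastic (B n)"
  shows "column_stochastic (mprod B n)"
  by (induction n) (use assms in \<open>auto simp: column_stochastic_mat1 intro!: column_stochastic_mult\<close>)

lemma one_inner_column_stochastic:
  assumes "column_stochastic B"
  shows "1 \<bullet> (B *v x) = 1 \<bullet> x"
proof -
  have "1 \<bullet> (B *v x) = (\<Sum>j\<in>UNIV. (\<Sum>i\<in>UNIV. B $ i $ j) * x $ j)"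
    unfolding one_inner_vec matrix_vector_mult_def by (simp add: sum_distrib_right) (rule sum.swap)
  then show ?thesis using assms by (simp add: column_stochastic_def one_inner_vec)
qed

text \<open>The image of \<open>x\<close> is dominated entrywise by that of the vector of absolute
  values, whose coordinate sum is preserved.\<close>

lemma norm_column_stochastic_le:
  assumes B: "column_stochastic B"
  shows "norm (B *v x) \<le> (\<Sum>j\<in>UNIV. \<bar>x $ j\<bar>)"
proof -
  have "norm (B *v x) \<le> (\<Sum>i\<in>UNIV. \<bar>(B *v x) $ i\<bar>)" by (rule norm_le_l1_cart)
  also have "\<dots> \<le> (\<Sum>i\<in>UNIV. (B *v (\<chi> j. \<bar>x $ j\<bar>)) $ i)"
  proof (rule sum_mono)
    fix i
    have "\<bar>(B *v x) $ i\<bar> \<le> (\<Sum>j\<in>UNIV. \<bar>B $ i $ j * x $ j\<bar>)"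
      unfolding matrix_vector_mult_def by simp
    also have "\<dots> = (B *v (\<chi> j. \<bar>x $ j\<bar>)) $ i"
      using B by (simp add: matrix_vector_mult_def abs_mult column_stochastic_def nonneg_mat_def)
    finally show "\<bar>(B *v x) $ i\<bar> \<le> (B *v (\<chi> j. \<bar>x $ j\<bar>)) $ i" .
  qed
  also have "\<dots> = (\<Sum>j\<in>UNIV. \<bar>x $ j\<bar>)"
    using one_inner_column_stochastic[OF B, of "\<chi> j. \<bar>x $ j\<bar>"] by (simp add: one_inner_vec)
  finally show ?thesis .
qed

lemma column_stochastic_large_entry:
  fixes B :: "real^'n^'m"
  assumes "column_stochastic B"
  obtains j where "1 / CARD('m) \<le> B $ j $ k"
proof (rule ccontr)
  assume "\<not> thesis"
  then have "(\<Sum>j\<in>UNIV. B $ j $ k) < (\<Sum>j\<in>(UNIV::'m set). 1 / CARD('m))"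
    using that by (intro sum_strict_mono) (auto intro: not_le_imp_less)
  then show False using assms by (simp add: column_stochastic_def)
qed

section \<open>Growth rates under column stochastic products\<close>

lemma growth_rate_column_stochastic_le:
  assumes "\<forall>n\<ge>1. column_stochastic (B n)"
  shows "growth_rate B v \<le> 0"
proof (rule growth_rate_leI)
  fix r assume r: "0 < ereal r"
  have "norm (mprod B n *v v) \<le> (\<Sum>j\<in>UNIV. \<bar>v $ j\<bar>) * exp (r * real n)" for n
  proof -
    have "norm (mprod B n *v v) \<le> (\<Sum>j\<in>UNIV. \<bar>v $ j\<bar>) * 1"
      using norm_column_stochastic_le[OF column_stochastic_mprod[OF assms]] by simp
    also have "\<dots> \<le> (\<Sum>j\<in>UNIV. \<bar>v $ j\<bar>) * exp (r * real n)"
      using r by (intro mult_left_mono sum_nonneg) auto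
    finally show ?thesis .
  qed
  then show "\<exists>C. \<forall>\<^sub>F n in sequentially. norm (mprod B n *v v) \<le> C * exp (r * real n)"
    by (blast intro: always_eventually)
qed

text \<open>The conserved quantity \<open>1 \<bullet> v\<close> keeps the orbit away from zero by
  the Cauchy-Schwarz inequality, which excludes exponential decay.\<close>

lemma growth_rate_column_stochastic_ge:
  assumes B: "\<forall>n\<ge>1. column_stochastic (B n)" and v: "1 \<bullet> v \<noteq> 0"
  shows "0 \<le> growth_rate B v"
proof (rule ccontr)
  assume "\<not> 0 \<le> growth_rate B v"
  then obtain r where r: "growth_rate B v < ereal r" "r < 0"
    by (metis ereal_dense2 less_ereal.simps(1) not_le zero_ereal_def)
  \<comment> \<open>The factor \<open>2\<close> turns the two opposing bounds on
    \<open>\<bar>1 \<bullet> v\<bar>\<close> into a strict contradiction.\<close>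
  have "\<forall>\<^sub>F n in sequentially. norm (1 :: real^'a) / \<bar>1 \<bullet> v\<bar> * 2 * exp (r * real n) \<le> exp (0 * real n)"
    by (rule eventually_mult_exp_le[OF r(2)])
  with growth_rate_leD[OF order.refl r(1)]
  have "\<forall>\<^sub>F n :: nat in sequentially. False"
  proof eventually_elim
    case (elim n)
    have "\<bar>1 \<bullet> v\<bar> = \<bar>1 \<bullet> (mprod B n *v v)\<bar>"
      by (simp add: one_inner_column_stochastic[OF column_stochastic_mprod[OF B]])
    also have "\<dots> \<le> norm (1 :: real^'a) * norm (mprod B n *v v)" by (rule Cauchy_Schwarz_ineq2)
    also have "\<dots> \<le> norm (1 :: real^'a) * exp (r * real n)"
      using elim(1) by (intro mult_left_mono) auto
    finally show False using elim(2) v by (simp add: field_simps)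
  qed
  then show False by simp
qed

lemma second_lyap_space_column_stochastic:
  fixes B :: "nat \<Rightarrow> real^'p^'p"
  assumes p: "2 \<le> CARD('p)"
    and B: "\<forall>n\<ge>1. column_stochastic (B n)"
    and gap: "lyapunov_exponent B 2 < lyapunov_exponent B 1"
  shows "lyapunov_exponent B 2 < 0"
    and "lyap_space B (lyapunov_exponent B 2) = {v. 1 \<bullet> v = 0}"
proof -
  obtain v where "growth_rate B v = lyapunov_exponent B 1"
    using simple_top_exponent(1)[OF p gap] by (metis imageE)
  then show neg: "lyapunov_exponent B 2 < 0"
    using growth_rate_column_stochastic_le[OF B, of v] gap by simp
  have sub: "lyap_space B (lyapunov_exponent B 2) \<subseteq> {v. 1 \<bullet> v = 0}"
    using growth_rate_column_stochastic_ge[OF B] neg unfolding lyap_space_def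
    by (metis (mono_tags, lifting) mem_Collect_eq not_le order.trans subsetI)
  \<comment> \<open>The inclusion of subspaces becomes an equality because the dimensions
    agree.\<close>
  have "dim {v :: real^'p. 1 \<bullet> v = 0} = CARD('p) - 1"
    using dim_hyperplane[of "1 :: real^'p"] by simp
  with sub show "lyap_space B (lyapunov_exponent B 2) = {v. 1 \<bullet> v = 0}"
    using simple_top_exponent(2)[OF p gap]
    by (intro subspace_dim_equal subspace_lyap_space subspace_hyperplane) auto
qed

section \<open>Positive rows and lower bounds for entries\<close>

text \<open>Each row of the product is a nonnegative combination of rows of \<open>C\<close>: it is
  positive as soon as a positive row enters with positive weight, and zero otherwise.\<close>

lemma rows_positive_or_zero_mult:
  assumes "nonneg_mat B" "nonneg_mat C" "rows_positive_or_zero C"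
  shows "rows_positive_or_zero (B ** C)"
  unfolding rows_positive_or_zero_def
proof
  fix i
  have row0: "row i D = 0 \<longleftrightarrow> (\<forall>j. D $ i $ j = 0)" for i and D :: "real^'c^'d"
    by (simp add: row_def vec_eq_iff)
  show "(\<forall>j. 0 < (B ** C) $ i $ j) \<or> row i (B ** C) = 0"
  proof (cases "\<exists>k. B $ i $ k > 0 \<and> (\<forall>j. C $ k $ j > 0)")
    case True
    then obtain k where k: "B $ i $ k > 0" "\<And>j. C $ k $ j > 0" by blast
    have "0 < (B ** C) $ i $ j" for j
      unfolding matrix_matrix_mult_def vec_lambda_beta
      by (rule sum_pos2[of _ k]) (use k assms in \<open>auto simp: nonneg_mat_def\<close>)
    then show ?thesis by blast
  next
    case False
    then have "B $ i $ k * C $ k $ j = 0" for k j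
      using assms unfolding rows_positive_or_zero_def nonneg_mat_def row0
      by (metis less_eq_real_def mult_eq_0_iff)
    then have "row i (B ** C) = 0"
      unfolding row0 matrix_matrix_mult_def vec_lambda_beta by (simp only: sum.neutral_const) simp
    then show ?thesis ..
  qed
qed

lemma rows_positive_or_zero_mprod:
  assumes B: "\<forall>n\<ge>1. column_stochastic (B n)"
    and "rows_positive_or_zero (mprod B N)" "N \<le> n"
  shows "rows_positive_or_zero (mprod B n)"
  using assms(3)
proof (induction n rule: dec_induct)
  case base
  then show ?case by fact
next
  case (step n)
  then show ?case
    using B[rule_format, of "Suc n"] column_stochastic_mprod[OF B, of n]
    by (auto simp: column_stochastic_def intro!: rows_positive_or_zero_mult)
qed

text \<open>In column \<open>k\<close> some entry is at least \<open>1 / CARD('p)\<close>, and its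
  ratio to the entry in row \<open>i\<close> grows subexponentially. After time \<open>N\<close> a
  nonzero row is positive, so this ratio is finite.\<close>

lemma eventually_entry_lower_bound:
  fixes B :: "nat \<Rightarrow> real^'p^'p"
  assumes B: "\<forall>n\<ge>1. column_stochastic (B n)"
    and prim: "rows_positive_or_zero (mprod B N)"
    and sub: "\<And>j. \<forall>\<^sub>F n in sequentially.
      \<bar>ereal (mprod B n $ j $ k) / ereal (mprod B n $ i $ k)\<bar> \<le> ereal (exp (\<epsilon> * real n))
      \<or> ereal (mprod B n $ j $ k) / ereal (mprod B n $ i $ k) = \<infinity>"
  shows "\<forall>\<^sub>F n in sequentially. row i (mprod B n) \<noteq> 0 \<longrightarrow>
    exp (- \<epsilon> * real n) / CARD('p) \<le> mprod B n $ i $ k"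
proof -
  have "\<forall>\<^sub>F n in sequentially. \<forall>j.
      \<bar>ereal (mprod B n $ j $ k) / ereal (mprod B n $ i $ k)\<bar> \<le> ereal (exp (\<epsilon> * real n))
      \<or> ereal (mprod B n $ j $ k) / ereal (mprod B n $ i $ k) = \<infinity>"
    \<comment> \<open>The bound must hold for all \<open>j\<close> at once, since the row of the
      large entry varies with \<open>n\<close>.\<close>
    by (rule eventually_all_finite) (rule sub)
  with eventually_ge_at_top[of N] show ?thesis
  proof eventually_elim
    case (elim n)
    show ?case
    proof
      assume "row i (mprod B n) \<noteq> 0"
      then have pos: "0 < mprod B n $ i $ k"
        using rows_positive_or_zero_mprod[OF B prim elim(1)]
        by (auto simp: rows_positive_or_zero_def)
      obtain j where j: "1 / CARD('p) \<le> mprod B n $ j $ k"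
        using column_stochastic_large_entry[OF column_stochastic_mprod[OF B]] .
      have "\<bar>mprod B n $ j $ k / mprod B n $ i $ k\<bar> \<le> exp (\<epsilon> * real n)"
        using elim(2)[rule_format, of j] pos by simp
      then have "mprod B n $ j $ k \<le> exp (\<epsilon> * real n) * mprod B n $ i $ k"
        using pos by (simp add: field_simps abs_le_iff)
      with j have "1 / CARD('p) \<le> exp (\<epsilon> * real n) * mprod B n $ i $ k" by simp
      then show "exp (- \<epsilon> * real n) / CARD('p) \<le> mprod B n $ i $ k"
        by (simp add: exp_minus field_simps)
    qed
  qed
qed

section \<open>Rate of convergence of the weighted averages\<close>

lemma weighted_average_convergence:
  fixes B :: "nat \<Rightarrow> real^'p^'p"
  assumes p: "2 \<le> CARD('p)"
    and B: "\<forall>n\<ge>1. column_stochastic (B n)"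
    and gap: "lyapunov_exponent B 2 < lyapunov_exponent B 1"
    and prim: "rows_positive_or_zero (mprod B N)"
    and sub: "\<And>\<epsilon> i j k. 0 < \<epsilon> \<Longrightarrow> \<forall>\<^sub>F n in sequentially.
      \<bar>ereal (mprod B n $ i $ k) / ereal (mprod B n $ j $ k)\<bar> \<le> ereal (exp (\<epsilon> * real n))
      \<or> ereal (mprod B n $ i $ k) / ereal (mprod B n $ j $ k) = \<infinity>"
    and w: "\<And>i. 0 \<le> w $ i" "w \<noteq> 0"
  shows "limsup_along {n. row i (mprod B n) \<noteq> 0}
      (\<lambda>n. elog \<bar>(mprod B n *v x) $ i / (mprod B n *v w) $ i - (1 \<bullet> x) / (1 \<bullet> w)\<bar> / ereal (real n))
      \<le> lyapunov_exponent B 2"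
  unfolding limsup_along_def
proof (rule Limsup_elog_leI)
  let ?S = "{n. row i (mprod B n) \<noteq> 0}"
  define y where "y = x - ((1 \<bullet> x) / (1 \<bullet> w)) *\<^sub>R w"
  \<comment> \<open>One positive weight suffices: all terms of the denominator are nonnegative, so
    its \<open>k\<close>th term bounds it from below.\<close>
  obtain k where "w $ k \<noteq> 0" using w by (auto simp: vec_eq_iff)
  with w have k: "0 < w $ k" by (simp add: order.not_eq_order_implies_strict)
  then have "0 < 1 \<bullet> w"
    unfolding one_inner_vec by (intro sum_pos2[of _ k]) (use w in auto)
  then have "1 \<bullet> y = 0" by (simp add: y_def inner_diff_right)
  then have y: "growth_rate B y \<le> lyapunov_exponent B 2"
    using second_lyap_space_column_stochastic(2)[OF p B gap] by (auto simp: lyap_space_def)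
  fix r assume r: "lyapunov_exponent B 2 < ereal r"
  then obtain s where s: "lyapunov_exponent B 2 < ereal s" "s < r"
    by (metis ereal_dense2 less_ereal.simps(1))
  \<comment> \<open>The numerator has rate \<open>s\<close>, and the denominator may lose a factor
    of rate \<epsilon>; together they give exactly \<open>r\<close>.\<close>
  define \<epsilon> where "\<epsilon> = r - s"
  have "\<epsilon> > 0" using s by (simp add: \<epsilon>_def)
  have "\<forall>\<^sub>F n in sequentially. row i (mprod B n) \<noteq> 0 \<longrightarrow>
      \<bar>(mprod B n *v x) $ i / (mprod B n *v w) $ i - (1 \<bullet> x) / (1 \<bullet> w)\<bar>
        \<le> CARD('p) / w $ k * exp (r * real n)"
    using growth_rate_leD[OF y s(1)]
      eventually_entry_lower_bound[OF B prim sub[of \<epsilon> _ k i, OF \<open>\<epsilon> > 0\<close>]]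
  proof eventually_elim
    case (elim n)
    show ?case
    proof
      assume "row i (mprod B n) \<noteq> 0"
      with elim have lo: "exp (- \<epsilon> * real n) / CARD('p) \<le> mprod B n $ i $ k" by blast
      have nn: "0 \<le> mprod B n $ i $ j" for j
        using column_stochastic_mprod[OF B, of n] by (simp add: column_stochastic_def nonneg_mat_def)
      have "mprod B n $ i $ k * w $ k \<le> (mprod B n *v w) $ i"
        unfolding matrix_vector_mult_def vec_lambda_beta
        by (rule member_le_sum) (use nn w in auto)
      moreover have "exp (- \<epsilon> * real n) / CARD('p) * w $ k \<le> mprod B n $ i $ k * w $ k"
        using lo k by (intro mult_right_mono) auto
      ultimately have den: "exp (- \<epsilon> * real n) / CARD('p) * w $ k \<le> (mprod B n *v w) $ i" by simp
      have dpos: "0 < exp (- \<epsilon> * real n) / CARD('p) * w $ k" using k by simp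
      have "(mprod B n *v y) $ i
          = (mprod B n *v x) $ i - (1 \<bullet> x) / (1 \<bullet> w) * (mprod B n *v w) $ i"
        by (simp add: y_def matrix_vector_mult_diff_distrib matrix_vector_mult_scaleR)
      then have "\<bar>(mprod B n *v x) $ i / (mprod B n *v w) $ i - (1 \<bullet> x) / (1 \<bullet> w)\<bar>
          = \<bar>(mprod B n *v y) $ i\<bar> / (mprod B n *v w) $ i"
        using less_le_trans[OF dpos den] by (simp add: divide_diff_eq_iff abs_divide)
      also have "\<dots> \<le> exp (s * real n) / (exp (- \<epsilon> * real n) / CARD('p) * w $ k)"
        using den dpos elim(1) component_le_norm_cart[of "mprod B n *v y" i]
        by (intro frac_le) auto
      also have "\<dots> = CARD('p) / w $ k * exp (r * real n)"
        by (simp add: \<epsilon>_def exp_minus exp_diff algebra_simps divide_simps)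
      finally show "\<bar>(mprod B n *v x) $ i / (mprod B n *v w) $ i - (1 \<bullet> x) / (1 \<bullet> w)\<bar>
          \<le> CARD('p) / w $ k * exp (r * real n)" .
    qed
  qed
  \<comment> \<open>An eventual bound conditional on a nonzero row is the same as an eventual bound
    along the filter restricted to \<open>?S\<close>.\<close>
  then show "\<exists>C. \<forall>\<^sub>F n in inf sequentially (principal ?S).
      \<bar>(mprod B n *v x) $ i / (mprod B n *v w) $ i - (1 \<bullet> x) / (1 \<bullet> w)\<bar> \<le> C * exp (r * real n)"
    unfolding eventually_inf_principal mem_Collect_eq by (rule exI)
qed auto

section \<open>Passage to almost every path\<close>

text \<open>The exceptional null set may depend on \<epsilon>. As the bound weakens when \<epsilon>
  grows, the countably many values \<open>1 / Suc m\<close> suffice, and their null sets can be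
  united.\<close>

lemma weakly_subexponential_AE_all:
  assumes "weakly_subexponential M \<xi>"
  shows "AE \<omega> in M. \<forall>\<epsilon>>0. \<forall>\<^sub>F n in sequentially.
    \<bar>\<xi> n \<omega>\<bar> \<le> ereal (exp (\<epsilon> * real n)) \<or> \<xi> n \<omega> = \<infinity>"
proof -
  have "AE \<omega> in M. \<forall>m::nat. \<forall>\<^sub>F n in sequentially.
      \<bar>\<xi> n \<omega>\<bar> \<le> ereal (exp (1 / Suc m * real n)) \<or> \<xi> n \<omega> = \<infinity>"
    unfolding AE_all_countable using assms unfolding weakly_subexponential_def
    by (intro allI) (erule allE, erule mp, simp)
  then show ?thesis
  proof eventually_elim
    case (elim \<omega>)
    show ?case
    proof (intro allI impI)
      fix \<epsilon> :: real assume "\<epsilon> > 0"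
      then obtain m where m: "1 / Suc m < \<epsilon>" using nat_approx_posE by blast
      show "\<forall>\<^sub>F n in sequentially. \<bar>\<xi> n \<omega>\<bar> \<le> ereal (exp (\<epsilon> * real n)) \<or> \<xi> n \<omega> = \<infinity>"
        using elim[rule_format, of m]
      proof eventually_elim
        case (elim n)
        have "1 / Suc m * real n \<le> \<epsilon> * real n" using m by (intro mult_right_mono) auto
        then have "ereal (exp (1 / Suc m * real n)) \<le> ereal (exp (\<epsilon> * real n))" by simp
        with elim show ?case by (meson order.trans)
      qed
    qed
  qed
qed

theorem theorem1p10:
  fixes M :: "'w measure"
    and A :: "nat \<Rightarrow> 'w \<Rightarrow> real^'p^'p"
    and x w :: "real^'p"
  assumes "prob_space M"
    and "2 \<le> CARD('p)"
    and "\<And>n. 1 \<le> n \<Longrightarrow> A n \<in> borel_measurable M"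
    and "strictly_stationary M A"
    and "ergodic_process M A"
    and "AE \<omega> in M. \<forall>n\<ge>1. nonneg_mat (A n \<omega>) \<and> column_allowable (A n \<omega>)"
    and "weakly_sequentially_primitive M A"
    and "integrable M (\<lambda>\<omega>. max 0 (ln (onorm (\<lambda>v. A 1 \<omega> *v v))))"
    and "AE \<omega> in M. lyapunov_exponent (\<lambda>n. A n \<omega>) 2 < lyapunov_exponent (\<lambda>n. A n \<omega>) 1"
    and "\<And>i j k. weakly_subexponential M (entry_ratio A i j k)"
    and "AE \<omega> in M. \<forall>n\<ge>1. column_stochastic (A n \<omega>)"
    and "\<forall>i. 0 \<le> w $ i" and "w \<noteq> 0"
  shows "AE \<omega> in M. \<forall>i.
      limsup_along {n. row i (mprod (\<lambda>k. A k \<omega>) n) \<noteq> 0}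
        (\<lambda>n. elog \<bar>(mprod (\<lambda>k. A k \<omega>) n *v x) $ i / (mprod (\<lambda>k. A k \<omega>) n *v w) $ i
                    - (1 \<bullet> x) / (1 \<bullet> w)\<bar> / ereal (real n))
        \<le> lyapunov_exponent (\<lambda>n. A n \<omega>) 2
      \<and> lyapunov_exponent (\<lambda>n. A n \<omega>) 2 < 0"
proof -
  \<comment> \<open>The index type is finite, so a single null set serves all triples
    \<open>i\<close>, \<open>j\<close>, \<open>k\<close>.\<close>
  have sub: "AE \<omega> in M. \<forall>i j k. \<forall>\<epsilon>>0. \<forall>\<^sub>F n in sequentially.
      \<bar>entry_ratio A i j k n \<omega>\<bar> \<le> ereal (exp (\<epsilon> * real n)) \<or> entry_ratio A i j k n \<omega> = \<infinity>"
    unfolding AE_all_countable using weakly_subexponential_AE_all[OF assms(10)] by blast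
  \<comment> \<open>The almost surely finite value of the stopping time provides \<open>N\<close> on
    each path.\<close>
  have prim: "AE \<omega> in M. \<exists>N. rows_positive_or_zero (mprod (\<lambda>k. A k \<omega>) N)"
    using assms(7) unfolding weakly_sequentially_primitive_def by (auto elim!: eventually_mono)
  show ?thesis
    using sub prim assms(9) assms(11)
  proof eventually_elim
    case (elim \<omega>)
    let ?B = "\<lambda>n. A n \<omega>"
    obtain N where N: "rows_positive_or_zero (mprod ?B N)" using elim(2) by blast
    show ?case
    proof (intro allI conjI)
      show "lyapunov_exponent ?B 2 < 0"
        using second_lyap_space_column_stochastic(1)[OF assms(2) elim(4) elim(3)] .
    next
      fix i
      show "limsup_along {n. row i (mprod ?B n) \<noteq> 0}
        (\<lambda>n. elog \<bar>(mprod ?B n *v x) $ i / (mprod ?B n *v w) $ i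
                    - (1 \<bullet> x) / (1 \<bullet> w)\<bar> / ereal (real n))
        \<le> lyapunov_exponent ?B 2"
        using elim(1) assms(12,13) unfolding entry_ratio_def
        by (intro weighted_average_convergence[OF assms(2) elim(4) elim(3) N]) auto
    qed
  qed
qed

end
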